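(* Let $n\ge 1$, let $\mathcal{L}\subset\mathbb{R}^{n+1}$ be an $(n+1)$-dimensional lattice, and let $V$ be a $\Gamma_{\mathcal{L}}$-irreducible subspace of $\mathcal{X}_{\mathcal{L}}$ generated by the orbit of $k\in\mathcal{L}^*$. If there exist $(u_1,z_1)$ and $(u_2,z_2)$ in $H_{\mathcal{L}}\cdot k$ (with $u_1,u_2\in\mathbb{R}^n$, $z_1,z_2\in\mathbb{R}$) such that $z_1\neq\pm z_2$, then for (Lebesgue) almost all $y_0>0$ the projection of the single mode $V$ is a mode interaction, that is, $\Pi_{y_0}(V)$ decomposes as a direct sum of $r>1$ nonzero $\widetilde{\Gamma}_{\widetilde{\mathcal{L}}}$-irreducible subspaces.
   Context: An $(n+1)$-dimensional lattice in $\mathbb{R}^{n+1}$ is the set of integer combinations of $n+1$ linearly independent vectors. Points of $\mathbb{R}^{n+1}$ are written $(x,y)$ with $x\in\mathbb{R}^n$, $y\in\mathbb{R}$. For a subgroup $\Lambda\subset\mathbb{R}^m$ let $\Lambda^*=\{k\in\mathbb{R}^m:\langle k,l\rangle\in\mathbb{Z}\text{ for all }l\in\Lambda\}$, let $\omega_k(u)=\exp(2\pi i\langle k,u\rangle)$, and let $\mathcal{X}_\Lambda$ be the space of real-valued functions on $\mathbb{R}^m$ that are invariant under translations in $\Lambda$ and admit a Fourier expansion in terms of the waves $\omega_k$, $k\in\Lambda^*$. The holohedry is the finite group $H_{\mathcal{L}}=\{\gamma\in O(n+1):\gamma\mathcal{L}=\mathcal{L}\}$, and $\Gamma_{\mathcal{L}}=\mathbb{R}^{n+1}/\mathcal{L}\dotplus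 H_{\mathcal{L}}$ (semidirect product) acts on $\mathcal{X}_{\mathcal{L}}$ by $((v,\delta)\cdot f)(u)=f(\delta^{-1}(u-v))$. For a group acting on a vector space, a subspace is invariant if it is mapped into itself by the group, and irreducible if it is invariant and contains no proper non-trivial invariant subspace. For $k\in\mathcal{L}^*$ let $V_k=\{\mathrm{Re}(c\,\omega_k):c\in\mathbb{C}\}$. The subspace generated by the orbit of $k$ is $V=V_{k_1}\oplus\cdots\oplus V_{k_s}$ where $\{\pm k_1,\ldots,\pm k_s\}=H_{\mathcal{L}}\cdot k$; these are known to be $\Gamma_{\mathcal{L}}$-irreducible. A bifurcation problem has a single mode bifurcation when the kernel of its linearisation is non-trivial and irreducible, and an $r$-mode interaction when this kernel is a direct sum of $r>1$ non-trivial irreducible components. For $y_0>0$, $\Pi_{y_0}(f)(x)=\int_0^{y_0}f(x,y)\,dy$. The set $\widetilde{\mathcal{L}}=\Pi_{y_0}(\mathcal{L})$ is the set of all $v\in\mathbb{R}^n$ such that every function in $\Pi_{y_0}(\mathcal{X}_{\mathcal{L}})$ is invariant under translation by $v$; it is known that $v\in\widetilde{\mathcal{L}}$ if and only if either $(v,0)\in\mathcal{L}$, or both $(0,y_0)\in\mathcal{L}$ and $(v,y_1)\in\mathcal{L}$ for some $y_1\in\mathbb{R}$. For $\alpha\in O(n)$ let $\alpha_\pm=\begin{pmatrix}\alpha&0\\0&\pm1\end{pmatrix}\in O(n+1)$. The group $\widetilde{J}=\Pi_{y_0}(H_{\mathcal{L}})\subset O(n)$ consists of those $\alpha$ such that either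 $\alpha_+\in H_{\mathcal{L}}$, or both $(0,y_0)\in\mathcal{L}$ and $\alpha_-\in H_{\mathcal{L}}$. The group $\widetilde{\Gamma}_{\widetilde{\mathcal{L}}}=\mathbb{R}^n/\widetilde{\mathcal{L}}\dotplus\widetilde{J}$ (semidirect product) acts on $\mathcal{X}_{\widetilde{\mathcal{L}}}$ by $((v,\alpha)\cdot g)(x)=g(\alpha^{-1}(x-v))$. The objects $\widetilde{\mathcal{L}},\widetilde{J},\widetilde{\Gamma}_{\widetilde{\mathcal{L}}}$ depend on $y_0$. *)

theory Defs
  imports
    "HOL-Analysis.Analysis"
    "HOL-Library.Function_Algebras"
    "HOL-Algebra.Coset"
begin

text \<open>
  Function spaces are real vector spaces with the pointwise operations, so that the library's
  \<^const>\<open>subspace\<close> and sums apply to sets of real-valued functions.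
\<close>

instantiation "fun" :: (type, real_vector) real_vector
begin

definition scaleR_fun :: "real \<Rightarrow> ('a \<Rightarrow> 'b) \<Rightarrow> 'a \<Rightarrow> 'b"
  where "scaleR_fun r f = (\<lambda>x. r *\<^sub>R f x)"

instance
  by standard (simp_all add: scaleR_fun_def plus_fun_def fun_eq_iff algebra_simps)

end

lemma scaleR_fun_apply [simp]: "(r *\<^sub>R f) x = r *\<^sub>R f x"
  by (simp add: scaleR_fun_def)


section \<open>Lattices, waves and spaces of periodic functions\<close>

definition full_lattice :: "'a::euclidean_space set \<Rightarrow> bool"
  where "full_lattice L \<longleftrightarrow>
    (\<exists>B. independent B \<and> card B = DIM('a) \<and>
         L = {\<Sum>b\<in>B. real_of_int (m b) *\<^sub>R b | m. True})"

definition dual :: "'a::real_inner set \<Rightarrow> 'a set"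
  where "dual \<Lambda> = {k. \<forall>l\<in>\<Lambda>. k \<bullet> l \<in> \<int>}"

definition wave :: "'a::real_inner \<Rightarrow> 'a \<Rightarrow> complex"
  where "wave k u = exp (2 * complex_of_real pi * \<i> * complex_of_real (k \<bullet> u))"

text \<open>
  A Fourier expansion is read as a pointwise unconditionally (equivalently, absolutely)
  convergent series of waves.  The dual of a subgroup that does not span the space is
  uncountable, which is why the expansion is indexed by the set itself.
\<close>

definition periodic_space :: "'a::real_inner set \<Rightarrow> ('a \<Rightarrow> real) set"
  where "periodic_space \<Lambda> =
    {f. (\<forall>l\<in>\<Lambda>. \<forall>u. f (u + l) = f u) \<and>
        (\<exists>c. \<forall>u. ((\<lambda>k. c k * wave k u) has_sum complex_of_real (f u)) (dual \<Lambda>))}"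

definition wave_space :: "'a::real_inner \<Rightarrow> ('a \<Rightarrow> real) set"
  where "wave_space k = {\<lambda>u. Re (c * wave k u) | c. True}"


section \<open>Symmetry groups and their actions\<close>

definition holohedry :: "'a::euclidean_space set \<Rightarrow> ('a \<Rightarrow> 'a) set"
  where "holohedry L = {\<gamma>. orthogonal_transformation \<gamma> \<and> \<gamma> ` L = L}"

definition translation_group :: "'a::ab_group_add monoid"
  where "translation_group = \<lparr>carrier = UNIV, mult = (+), one = 0\<rparr>"

text \<open>
  The semidirect product of the quotient of the translations by \<open>\<Lambda>\<close> with a group \<open>H\<close> of linear
  maps preserving \<open>\<Lambda>\<close>: \<open>(v + \<Lambda>, \<gamma>) \<cdot> (w + \<Lambda>, \<delta>) = (v + \<gamma> w + \<Lambda>, \<gamma> \<circ> \<delta>)\<close>.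
\<close>

definition symmetry_group ::
    "'a::ab_group_add set \<Rightarrow> ('a \<Rightarrow> 'a) set \<Rightarrow> ('a set \<times> ('a \<Rightarrow> 'a)) monoid"
  where "symmetry_group \<Lambda> H =
    \<lparr>carrier = carrier (translation_group Mod \<Lambda>) \<times> H,
     mult = (\<lambda>(A, \<gamma>) (B, \<delta>). (A \<otimes>\<^bsub>translation_group Mod \<Lambda>\<^esub> (\<gamma> ` B), \<gamma> \<circ> \<delta>)),
     one = (\<one>\<^bsub>translation_group Mod \<Lambda>\<^esub>, id)\<rparr>"

text \<open>
  The action \<open>((v, \<delta>) \<cdot> f) u = f (\<delta>\<^sup>-\<^sup>1 (u - v))\<close>.  A coset acts through a chosen representative;
  on \<open>\<Lambda>\<close>-periodic functions the choice is immaterial, see \<open>sym_act_coset\<close> below.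
\<close>

definition sym_act :: "'a set \<times> ('a \<Rightarrow> 'a) \<Rightarrow> ('a \<Rightarrow> real) \<Rightarrow> 'a::ab_group_add \<Rightarrow> real"
  where "sym_act g f = (case g of (A, \<delta>) \<Rightarrow> \<lambda>u. f (inv_into UNIV \<delta> (u - (SOME v. v \<in> A))))"

lemma carrier_translation_quotient:
  "carrier (translation_group Mod \<Lambda>) = range (\<lambda>v. (\<lambda>l. l + v) ` \<Lambda>)"
  by (auto simp: carrier_FactGroup translation_group_def r_coset_def image_def)

lemma sym_act_coset:
  fixes \<Lambda> :: "'a::real_inner set"
  assumes f: "f \<in> periodic_space \<Lambda>" and \<delta>: "linear \<delta>" "bij \<delta>" "\<delta> ` \<Lambda> = \<Lambda>"
    and ne: "\<Lambda> \<noteq> {}"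
  shows "sym_act ((\<lambda>l. l + v) ` \<Lambda>, \<delta>) f u = f (inv_into UNIV \<delta> (u - v))"
proof -
  define w where "w = (SOME w. w \<in> (\<lambda>l. l + v) ` \<Lambda>)"
  have "w \<in> (\<lambda>l. l + v) ` \<Lambda>"
    unfolding w_def by (rule someI_ex) (use ne in auto)
  then obtain l where "l \<in> \<Lambda>" "w = l + v" by auto
  then obtain m where m: "m \<in> \<Lambda>" "w = \<delta> m + v" using \<delta>(3) by auto
  define x where "x = inv_into UNIV \<delta> (u - w)"
  have x: "\<delta> x = u - w"
    using \<delta>(2) by (simp add: x_def bij_def surj_f_inv_f)
  have "\<delta> (x + m) = u - v"
    using x m(2) \<delta>(1) by (simp add: linear_add)
  then have "inv_into UNIV \<delta> (u - v) = x + m"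
    using \<delta>(2) by (metis bij_inv_eq_iff)
  then show ?thesis
    using f m(1) by (simp add: sym_act_def w_def[symmetric] x_def[symmetric] periodic_space_def)
qed

lemma group_symmetry_group:
  fixes \<Lambda> :: "'a::real_vector set"
  assumes \<Lambda>: "0 \<in> \<Lambda>" "\<And>a b. a \<in> \<Lambda> \<Longrightarrow> b \<in> \<Lambda> \<Longrightarrow> a - b \<in> \<Lambda>"
    and H: "id \<in> H" "\<And>\<gamma> \<delta>. \<gamma> \<in> H \<Longrightarrow> \<delta> \<in> H \<Longrightarrow> \<gamma> \<circ> \<delta> \<in> H"
      "\<And>\<gamma>. \<gamma> \<in> H \<Longrightarrow> inv_into UNIV \<gamma> \<in> H"
    and lin: "\<And>\<gamma>. \<gamma> \<in> H \<Longrightarrow> linear \<gamma>" "\<And>\<gamma>. \<gamma> \<in> H \<Longrightarrow> bij \<gamma>" "\<And>\<gamma>. \<gamma> \<in> H \<Longrightarrow> \<gamma> ` \<Lambda> = \<Lambda>"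
  shows "group (symmetry_group \<Lambda> H)"
proof -
  have tg: "comm_group (translation_group :: 'a monoid)"
    by (rule comm_groupI)
      (auto simp: translation_group_def algebra_simps intro: exI[of _ "- x" for x])
  interpret T: comm_group "translation_group :: 'a monoid" by (rule tg)
  have inv_T: "inv\<^bsub>translation_group\<^esub> (a::'a) = - a" for a
    by (rule T.inv_equality) (auto simp: translation_group_def)
  have add: "a + b \<in> \<Lambda>" if "a \<in> \<Lambda>" "b \<in> \<Lambda>" for a b
    using \<Lambda>(2)[OF that(1) \<Lambda>(2)[OF \<Lambda>(1) that(2)]] by simp
  have sub: "subgroup \<Lambda> translation_group"
    using \<Lambda>(1) \<Lambda>(2)[OF \<Lambda>(1)] add
    by (intro T.subgroupI) (auto simp: inv_T, auto simp: translation_group_def)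
  interpret N: normal \<Lambda> translation_group
    by (rule T.normal_iff_subgroup[THEN iffD2, OF sub])
  let ?Q = "translation_group Mod \<Lambda>"
  interpret Q: group ?Q by (rule N.factorgroup_is_group)
  define C where "C v = (\<lambda>l. l + v) ` \<Lambda>" for v :: 'a
  have carr: "carrier ?Q = range C"
    unfolding C_def by (rule carrier_translation_quotient)
  have C_rcos: "C v = \<Lambda> #>\<^bsub>translation_group\<^esub> v" for v
    by (auto simp: C_def r_coset_def translation_group_def)
  have multC: "C v \<otimes>\<^bsub>?Q\<^esub> C w = C (v + w)" for v w
    using N.rcos_sum[of v w] by (simp add: C_rcos) (simp add: translation_group_def)
  have oneC: "\<one>\<^bsub>?Q\<^esub> = C 0"
    by (simp add: C_def)
  have img: "\<gamma> ` C v = C (\<gamma> v)" if "\<gamma> \<in> H" for \<gamma> v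
  proof -
    have "\<gamma> ` C v = (\<lambda>l. l + \<gamma> v) ` (\<gamma> ` \<Lambda>)"
      using lin(1)[OF that] by (simp add: C_def image_image linear_add)
    then show ?thesis by (simp add: C_def lin(3)[OF that])
  qed
  have mult: "(C v, \<gamma>) \<otimes>\<^bsub>symmetry_group \<Lambda> H\<^esub> (C w, \<delta>) = (C (v + \<gamma> w), \<gamma> \<circ> \<delta>)"
    if "\<gamma> \<in> H" for v w \<gamma> \<delta>
    using multC img[OF that] by (simp add: symmetry_group_def)
  have carr': "carrier (symmetry_group \<Lambda> H) = range C \<times> H"
    by (simp add: symmetry_group_def carr)
  have one: "\<one>\<^bsub>symmetry_group \<Lambda> H\<^esub> = (C 0, id)"
    using oneC by (simp add: symmetry_group_def)
  show ?thesis
  proof (rule groupI)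
    fix p q assume "p \<in> carrier (symmetry_group \<Lambda> H)" "q \<in> carrier (symmetry_group \<Lambda> H)"
    then show "p \<otimes>\<^bsub>symmetry_group \<Lambda> H\<^esub> q \<in> carrier (symmetry_group \<Lambda> H)"
      by (auto simp: carr' mult H(2))
  next
    show "\<one>\<^bsub>symmetry_group \<Lambda> H\<^esub> \<in> carrier (symmetry_group \<Lambda> H)"
      by (auto simp: carr' one H(1))
  next
    fix p q r
    assume "p \<in> carrier (symmetry_group \<Lambda> H)" "q \<in> carrier (symmetry_group \<Lambda> H)"
      "r \<in> carrier (symmetry_group \<Lambda> H)"
    then show "p \<otimes>\<^bsub>symmetry_group \<Lambda> H\<^esub> q \<otimes>\<^bsub>symmetry_group \<Lambda> H\<^esub> r =
      p \<otimes>\<^bsub>symmetry_group \<Lambda> H\<^esub> (q \<otimes>\<^bsub>symmetry_group \<Lambda> H\<^esub> r)"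
      by (auto simp: carr' mult H(2) linear_add[OF lin(1)] comp_assoc add.assoc)
  next
    fix p assume "p \<in> carrier (symmetry_group \<Lambda> H)"
    then show "\<one>\<^bsub>symmetry_group \<Lambda> H\<^esub> \<otimes>\<^bsub>symmetry_group \<Lambda> H\<^esub> p = p"
      by (auto simp: carr' one mult H(1))
  next
    fix p assume "p \<in> carrier (symmetry_group \<Lambda> H)"
    then obtain v \<gamma> where p: "p = (C v, \<gamma>)" "\<gamma> \<in> H" by (auto simp: carr')
    let ?\<delta> = "inv_into UNIV \<gamma>"
    have "(C (- ?\<delta> v), ?\<delta>) \<otimes>\<^bsub>symmetry_group \<Lambda> H\<^esub> p = \<one>\<^bsub>symmetry_group \<Lambda> H\<^esub>"
      using lin(2)[OF p(2)] by (simp add: p(1) mult[OF H(3)[OF p(2)]] one bij_def)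
    moreover have "(C (- ?\<delta> v), ?\<delta>) \<in> carrier (symmetry_group \<Lambda> H)"
      using H(3)[OF p(2)] by (simp add: carr')
    ultimately show "\<exists>q\<in>carrier (symmetry_group \<Lambda> H).
        q \<otimes>\<^bsub>symmetry_group \<Lambda> H\<^esub> p = \<one>\<^bsub>symmetry_group \<Lambda> H\<^esub>" by blast
  qed
qed


section \<open>Irreducible subspaces, direct sums and mode interactions\<close>

definition invariant_subspace ::
    "('g, 'm) monoid_scheme \<Rightarrow> ('g \<Rightarrow> 'v \<Rightarrow> 'v) \<Rightarrow> 'v set \<Rightarrow> 'v::real_vector set \<Rightarrow> bool"
  where "invariant_subspace G act X W \<longleftrightarrow>
    subspace W \<and> W \<subseteq> X \<and> (\<forall>g\<in>carrier G. act g ` W \<subseteq> W)"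

definition irreducible_subspace ::
    "('g, 'm) monoid_scheme \<Rightarrow> ('g \<Rightarrow> 'v \<Rightarrow> 'v) \<Rightarrow> 'v set \<Rightarrow> 'v::real_vector set \<Rightarrow> bool"
  where "irreducible_subspace G act X W \<longleftrightarrow>
    invariant_subspace G act X W \<and>
    (\<forall>U. invariant_subspace G act X U \<and> U \<subseteq> W \<longrightarrow> U = {0} \<or> U = W)"

definition is_direct_sum :: "'i set \<Rightarrow> ('i \<Rightarrow> 'v set) \<Rightarrow> 'v::real_vector set \<Rightarrow> bool"
  where "is_direct_sum I W V \<longleftrightarrow>
    finite I \<and> (\<forall>i\<in>I. subspace (W i)) \<and>
    V = {\<Sum>i\<in>I. w i | w. \<forall>i\<in>I. w i \<in> W i} \<and>
    (\<forall>w. (\<forall>i\<in>I. w i \<in> W i) \<and> (\<Sum>i\<in>I. w i) = 0 \<longrightarrow> (\<forall>i\<in>I. w i = 0))"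

definition mode_interaction ::
    "('g, 'm) monoid_scheme \<Rightarrow> ('g \<Rightarrow> 'v \<Rightarrow> 'v) \<Rightarrow> 'v set \<Rightarrow> 'v::real_vector set \<Rightarrow> bool"
  where "mode_interaction G act X V \<longleftrightarrow>
    (\<exists>(r::nat) > 1. \<exists>W. is_direct_sum {..<r} W V \<and>
       (\<forall>i<r. W i \<noteq> {0} \<and> irreducible_subspace G act X (W i)))"

definition holohedry_orbit :: "'a::euclidean_space set \<Rightarrow> 'a \<Rightarrow> 'a set"
  where "holohedry_orbit L k = {\<gamma> k | \<gamma>. \<gamma> \<in> holohedry L}"

text \<open>
  \<open>K\<close> is the set \<open>{k\<^sub>1, \<dots>, k\<^sub>s}\<close>.  Since \<open>wave_space (- k) = wave_space k \<noteq> {0}\<close>, directness of the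
  sum forces \<open>K\<close> to contain exactly one vector of each pair \<open>\<plusminus> k\<^sub>i\<close>.
\<close>

definition generated_by_orbit ::
    "'a::euclidean_space set \<Rightarrow> 'a \<Rightarrow> ('a \<Rightarrow> real) set \<Rightarrow> bool"
  where "generated_by_orbit L k V \<longleftrightarrow>
    (\<exists>K. K \<union> uminus ` K = holohedry_orbit L k \<and> is_direct_sum K wave_space V)"


section \<open>Projection\<close>

definition proj :: "real \<Rightarrow> ('a \<times> real \<Rightarrow> real) \<Rightarrow> 'a \<Rightarrow> real"
  where "proj y0 f = (\<lambda>x. integral {0..y0} (\<lambda>y. f (x, y)))"

definition proj_lattice :: "real \<Rightarrow> ('a::real_inner \<times> real) set \<Rightarrow> 'a set"
  where "proj_lattice y0 L = {v. \<forall>g \<in> proj y0 ` periodic_space L. \<forall>x. g (x + v) = g x}"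

definition proj_holohedry ::
    "real \<Rightarrow> ('a::euclidean_space \<times> real) set \<Rightarrow> ('a \<Rightarrow> 'a) set"
  where "proj_holohedry y0 L =
    {\<alpha>. orthogonal_transformation \<alpha> \<and>
        (map_prod \<alpha> id \<in> holohedry L \<or>
         (0, y0) \<in> L \<and> map_prod \<alpha> uminus \<in> holohedry L)}"

definition lattice_Gamma :: "'a::euclidean_space set \<Rightarrow> ('a set \<times> ('a \<Rightarrow> 'a)) monoid"
  where "lattice_Gamma L = symmetry_group L (holohedry L)"

definition proj_Gamma ::
    "real \<Rightarrow> ('a::euclidean_space \<times> real) set \<Rightarrow> ('a set \<times> ('a \<Rightarrow> 'a)) monoid"
  where "proj_Gamma y0 L = symmetry_group (proj_lattice y0 L) (proj_holohedry y0 L)"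

end

theory Submission
  imports Defs
begin

text \<open>
  Projecting \<open>Re (c \<omega>\<^bsub>(u,z)\<^esub>)\<close> multiplies \<open>c\<close> by the integral of \<open>exp (2\<pi>izy)\<close> over \<open>[0, y\<^sub>0]\<close>, which
  vanishes only if \<open>z \<noteq> 0\<close> and \<open>z y\<^sub>0\<close> is an integer.  Outside a countable set of \<open>y\<^sub>0\<close> the projection of
  \<open>V\<close> is therefore the sum of the \<open>V\<^sub>u\<close> with \<open>(u, z)\<close> in the orbit of \<open>k\<close>.  The spaces \<open>V\<^sub>u\<close> are
  irreducible and, up to \<open>u \<mapsto> -u\<close>, pairwise inequivalent under translations, so the irreducible
  summands correspond to the orbits of the projected holohedry on the set of pairs \<open>\<plusminus>u\<close>.  Since
  \<open>|u\<^sub>1|\<^sup>2 + z\<^sub>1\<^sup>2 = |u\<^sub>2|\<^sup>2 + z\<^sub>2\<^sup>2\<close> and \<open>z\<^sub>1 \<noteq> \<plusminus>z\<^sub>2\<close>, the norms of \<open>u\<^sub>1\<close> and \<open>u\<^sub>2\<close> differ, hence there are at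
  least two orbits.
\<close>

section \<open>Waves and their translates\<close>

text \<open>Without this the simplifier splits \<open>Re (c * wave k u)\<close> into real and imaginary parts.\<close>

declare times_complex.sel [simp del]

lemma Re_of_real_mult: "Re (of_real r * z) = r * Re z" "Re (z * of_real r) = r * Re z"
  by (simp_all add: times_complex.sel)

lemma sum_fun_apply [simp]: "(\<Sum>i\<in>I. w i) x = (\<Sum>i\<in>I. w i x)"
  for w :: "'i \<Rightarrow> 'a \<Rightarrow> real"
  by (induction I rule: infinite_finite_induct) auto

lemma wave_add: "wave k (u + v) = wave k u * wave k v"
  by (simp add: wave_def inner_add_right exp_add[symmetric] algebra_simps)

lemma wave_zero [simp]: "wave k 0 = 1" "wave 0 u = 1"
  by (simp_all add: wave_def)

lemma wave_uminus: "wave (- k) u = cnj (wave k u)" "wave k (- u) = cnj (wave k u)"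
  by (simp_all add: wave_def exp_cnj)

lemma wave_eq_cis: "wave k u = cis (2 * pi * (k \<bullet> u))"
  by (simp add: wave_def cis_conv_exp algebra_simps)

lemma wave_eq_1_iff: "wave k u = 1 \<longleftrightarrow> k \<bullet> u \<in> \<int>"
proof -
  have "wave k u = 1 \<longleftrightarrow> (\<exists>n::int. 2 * pi * (k \<bullet> u) = real_of_int (2 * n) * pi)"
    by (simp add: wave_def exp_eq_1 times_complex.sel)
  also have "\<dots> \<longleftrightarrow> (\<exists>n::int. k \<bullet> u = real_of_int n)"
    by (intro ex_cong1) auto
  finally show ?thesis by (auto simp: Ints_def)
qed

lemma wave_pair: "wave (u, z) (x, y) = wave u x * wave z y"
  by (simp add: wave_def inner_Pair exp_add[symmetric] algebra_simps)

lemma wave_spaceI [intro]: "(\<lambda>u. Re (c * wave k u)) \<in> wave_space k"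
  by (auto simp: wave_space_def)

lemma wave_spaceE:
  assumes "f \<in> wave_space k"
  obtains c where "f = (\<lambda>u. Re (c * wave k u))"
  using assms by (auto simp: wave_space_def)

lemma subspace_wave_space [simp]: "subspace (wave_space k)"
proof (rule subspaceI)
  show "0 \<in> wave_space k"
    using wave_spaceI[of 0 k] by (simp add: zero_fun_def)
next
  fix f g assume "f \<in> wave_space k" "g \<in> wave_space k"
  then obtain c d where "f = (\<lambda>u. Re (c * wave k u))" "g = (\<lambda>u. Re (d * wave k u))"
    by (elim wave_spaceE)
  then have "f + g = (\<lambda>u. Re ((c + d) * wave k u))" by (simp add: fun_eq_iff algebra_simps)
  then show "f + g \<in> wave_space k" by auto
next
  fix r f assume "f \<in> wave_space k"
  then obtain c where "f = (\<lambda>u. Re (c * wave k u))" by (elim wave_spaceE)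
  then have "r *\<^sub>R f = (\<lambda>u. Re ((of_real r * c) * wave k u))"
    by (simp add: fun_eq_iff mult.assoc Re_of_real_mult)
  then show "r *\<^sub>R f \<in> wave_space k" by auto
qed

text \<open>Conjugation preserves the real part and exchanges \<open>wave (- k)\<close> with
  \<open>wave k\<close>. Frequencies therefore matter only up to sign.\<close>

lemma wave_space_uminus [simp]: "wave_space (- k) = wave_space k"
proof -
  have "wave_space (- k) \<subseteq> wave_space k" for k :: 'a
  proof
    fix f assume "f \<in> wave_space (- k)"
    then obtain c where "f = (\<lambda>u. Re (c * wave (- k) u))" by (elim wave_spaceE)
    moreover have "Re (c * wave (- k) u) = Re (cnj c * wave k u)" for u
      using complex_cnj_mult[of c "wave (- k) u"] by (metis cnj.sel(1) complex_cnj_cnj wave_uminus(1))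
    ultimately have "f = (\<lambda>u. Re (cnj c * wave k u))" by simp
    then show "f \<in> wave_space k" by auto
  qed
  from this[of k] this[of "- k"] show ?thesis by auto
qed

lemma wave_space_nontrivial: "wave_space k \<noteq> {0}"
proof -
  have "(\<lambda>u. Re (1 * wave k u)) \<in> wave_space k" by blast
  moreover have "(\<lambda>u. Re (1 * wave k u)) \<noteq> 0"
    by (auto simp: fun_eq_iff intro!: exI[of _ 0])
  ultimately show ?thesis by blast
qed

lemma wave_space_translate:
  assumes "f \<in> wave_space k"
  shows "(\<lambda>x. f (x - v)) \<in> wave_space k"
proof -
  obtain c where "f = (\<lambda>u. Re (c * wave k u))" using assms by (elim wave_spaceE)
  then have "(\<lambda>x. f (x - v)) = (\<lambda>x. Re ((c * wave k (- v)) * wave k x))"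
    using wave_add[of k _ "- v"] by (simp add: ac_simps)
  then show ?thesis by auto
qed

text \<open>One translation multiplies \<open>c\<close> by a phase, in general not a real scaling of
  \<open>f\<close>. Adding the opposite translation combines conjugate phases into a real
  scalar.\<close>

lemma wave_space_symmetrized_translate:
  assumes "f \<in> wave_space k"
  shows "f (x - v) + f (x + v) = 2 * cos (2 * pi * (k \<bullet> v)) * f x"
proof -
  obtain c where f: "f = (\<lambda>u. Re (c * wave k u))" using assms by (elim wave_spaceE)
  have "f (x - v) + f (x + v) = Re ((c * wave k x) * (wave k v + cnj (wave k v)))"
    using wave_add[of k x v] wave_add[of k x "- v"]
    by (simp add: f wave_uminus algebra_simps)
  also have "wave k v + cnj (wave k v) = of_real (2 * cos (2 * pi * (k \<bullet> v)))"
    by (simp add: complex_add_cnj wave_eq_cis)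
  finally show ?thesis by (simp only: f Re_of_real_mult)
qed

text \<open>The difference of cosines is twice the product of the sines of pi times the inner
  products of \<open>v\<close> with \<open>a + b\<close> and \<open>b - a\<close>. A short
  \<open>v\<close> orthogonal to neither vector makes both sines nonzero.\<close>

lemma exists_separating_translation:
  fixes a b :: "'a::real_inner"
  assumes "a \<noteq> b" "a \<noteq> - b"
  shows "\<exists>v. cos (2 * pi * (a \<bullet> v)) \<noteq> cos (2 * pi * (b \<bullet> v))"
proof -
  define p q where "p = a + b" and "q = b - a"
  have pq: "p \<bullet> p \<noteq> 0" "q \<bullet> q \<noteq> 0"
    using assms by (auto simp: p_def q_def add_eq_0_iff2)
  \<comment> \<open>If \<open>p\<close> and \<open>q\<close> are orthogonal, their sum has nonzero
    inner product with both; otherwise \<open>p\<close> does.\<close>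
  obtain w where w: "p \<bullet> w \<noteq> 0" "q \<bullet> w \<noteq> 0"
  proof (cases "p \<bullet> q = 0")
    case True
    then show ?thesis using that[of "p + q"] pq by (simp add: inner_add_right inner_commute)
  next
    case False
    then show ?thesis using that[of p] pq by (simp add: inner_commute)
  qed
  \<comment> \<open>This scaling keeps each \<open>t * s\<close> below 1 in absolute value, where
    \<open>sin (pi * x)\<close> vanishes only at 0.\<close>
  define t where "t = 1 / (2 * (\<bar>p \<bullet> w\<bar> + \<bar>q \<bullet> w\<bar>))"
  have sin_nz: "sin (pi * (t * s)) \<noteq> 0" if "s \<noteq> 0" "\<bar>s\<bar> \<le> \<bar>p \<bullet> w\<bar> + \<bar>q \<bullet> w\<bar>" for s
  proof -
    have 1: "0 < \<bar>t * s\<bar>" "\<bar>t * s\<bar> < 1"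
      using that w by (auto simp: t_def abs_mult field_simps)
    then have "0 < sin (pi * \<bar>t * s\<bar>)"
      by (intro sin_gt_zero) auto
    then show ?thesis by (cases "t * s \<ge> 0") (auto simp: abs_if)
  qed
  have "sin (pi * (t * (p \<bullet> w))) * sin (pi * (t * (q \<bullet> w))) \<noteq> 0"
    using sin_nz[of "p \<bullet> w"] sin_nz[of "q \<bullet> w"] w by auto
  moreover have "cos (2 * pi * (a \<bullet> (t *\<^sub>R w))) - cos (2 * pi * (b \<bullet> (t *\<^sub>R w)))
      = 2 * sin (pi * (t * (p \<bullet> w))) * sin (pi * (t * (q \<bullet> w)))"
    proof -
    have "(2 * pi * (a \<bullet> (t *\<^sub>R w)) + 2 * pi * (b \<bullet> (t *\<^sub>R w))) / 2 = pi * (t * (p \<bullet> w))"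
      "(2 * pi * (b \<bullet> (t *\<^sub>R w)) - 2 * pi * (a \<bullet> (t *\<^sub>R w))) / 2 = pi * (t * (q \<bullet> w))"
      by (simp_all add: p_def q_def inner_add_left inner_diff_left field_simps)
    then show ?thesis by (simp only: cos_diff_cos)
  qed
  ultimately show ?thesis by (intro exI[of _ "t *\<^sub>R w"]) auto
qed


section \<open>Translation-invariant spaces of trigonometric polynomials\<close>

text \<open>No periodicity is built in, so \<open>{0}\<close> and all wave spans qualify: the same
  lemmas then serve directness of sums and irreducibility.\<close>

definition translation_invariant :: "('a::ab_group_add \<Rightarrow> real) set \<Rightarrow> bool"
  where "translation_invariant U \<longleftrightarrow> subspace U \<and> (\<forall>f\<in>U. \<forall>v. (\<lambda>x. f (x - v)) \<in> U)"

text \<open>A span tolerates repeated wave spaces, so \<open>S\<close> may contain both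
  \<open>u\<close> and \<open>- u\<close>.\<close>

definition wave_span :: "'a::real_inner set \<Rightarrow> ('a \<Rightarrow> real) set"
  where "wave_span S = span (\<Union>u\<in>S. wave_space u)"

lemma subspace_wave_span [simp]: "subspace (wave_span S)"
  by (simp add: wave_span_def)

lemma wave_span_mono: "S \<subseteq> T \<Longrightarrow> wave_span S \<subseteq> wave_span T"
  unfolding wave_span_def by (intro span_mono) auto

lemma wave_space_subset_wave_span: "u \<in> S \<Longrightarrow> wave_space u \<subseteq> wave_span S"
  unfolding wave_span_def by (auto intro: span_base)

lemma wave_span_subset:
  assumes "subspace U" "\<And>u. u \<in> S \<Longrightarrow> wave_space u \<subseteq> U"
  shows "wave_span S \<subseteq> U"
  unfolding wave_span_def using assms by (intro span_minimal) auto

lemma wave_span_empty [simp]: "wave_span {} = {0}"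
  by (simp add: wave_span_def)

lemma wave_span_insertE:
  assumes "f \<in> wave_span (insert a A)"
  obtains h g where "h \<in> wave_space a" "g \<in> wave_span A" "f = h + g"
proof -
  have "wave_span (insert a A) = {x + y | x y. x \<in> wave_space a \<and> y \<in> wave_span A}"
    by (simp add: wave_span_def span_Un span_eq_iff[THEN iffD2])
  then show ?thesis using assms that by blast
qed

lemma wave_span_insert_redundant:
  assumes "a \<in> A \<or> - a \<in> A"
  shows "wave_span (insert a A) = wave_span A"
proof
  have "wave_space u \<subseteq> wave_span A" if "u \<in> insert a A" for u
    using that assms wave_space_subset_wave_span[of u A] wave_space_subset_wave_span[of "- u" A]
    by auto
  then show "wave_span (insert a A) \<subseteq> wave_span A"
    by (rule wave_span_subset[OF subspace_wave_span])
qed (auto intro!: wave_span_mono)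

lemma linear_precomp: "linear (\<lambda>f x. (f (\<phi> x) :: real))"
  by (rule linearI) auto

lemma wave_span_linear_image:
  assumes "linear \<Phi>" "\<And>u f. u \<in> S \<Longrightarrow> f \<in> wave_space u \<Longrightarrow> \<Phi> f \<in> wave_span T"
  shows "\<Phi> ` wave_span S \<subseteq> wave_span T"
proof -
  have "\<Phi> ` wave_span S = span (\<Phi> ` (\<Union>u\<in>S. wave_space u))"
    unfolding wave_span_def by (rule linear_span_image[OF assms(1), symmetric])
  also have "\<dots> \<subseteq> wave_span T"
    using assms(2) by (intro span_minimal) auto
  finally show ?thesis .
qed

lemma translation_invariant_wave_span: "translation_invariant (wave_span S)"
proof -
  have "(\<lambda>f x. f (x - v)) ` wave_span S \<subseteq> wave_span S" for v
    using wave_space_translate wave_space_subset_wave_span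
    by (intro wave_span_linear_image[OF linear_precomp]) (blast dest: subsetD)
  then show ?thesis by (auto simp: translation_invariant_def)
qed

lemma translation_invariant_zero: "translation_invariant {0}"
  by (auto simp: translation_invariant_def fun_eq_iff)

lemma translation_invariant_symmetrized:
  assumes "translation_invariant U" "f \<in> U"
  shows "(\<lambda>x. f (x - v) + f (x + v) - r * f x) \<in> U"
proof -
  have "subspace U" "(\<lambda>x. f (x - v)) \<in> U" "(\<lambda>x. f (x - (- v))) \<in> U"
    using assms unfolding translation_invariant_def by blast+
  then have "(\<lambda>x. f (x - v)) + (\<lambda>x. f (x - (- v))) - r *\<^sub>R f \<in> U"
    using assms(2) by (intro subspace_diff subspace_add subspace_mul)
  then show ?thesis by (simp add: plus_fun_def fun_diff_def scaleR_fun_def)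
qed

text \<open>
  The operator \<open>f \<mapsto> f(\<cdot> - v) + f(\<cdot> + v)\<close> acts on \<open>V\<^sub>u\<close> as the scalar \<open>2 cos (2\<pi> \<langle>u, v\<rangle>)\<close>, so
  subtracting the scalar belonging to \<open>b\<close> removes the \<open>b\<close>-component and rescales the others.
\<close>

lemma wave_component_in_invariant:
  assumes U: "translation_invariant U" and "finite B"
    and "h \<in> wave_space a" "g \<in> wave_span B" "h + g \<in> U"
    and "a \<notin> B" "- a \<notin> B"
  shows "h \<in> U"
  using assms(2-)
proof (induction B arbitrary: h g rule: finite_induct)
  case empty
  then show ?case by simp
next
  case (insert b B)
  obtain p g' where p: "p \<in> wave_space b" and g': "g' \<in> wave_span B" and g: "g = p + g'"
    using insert.prems(2) by (rule wave_span_insertE)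
  have "a \<noteq> b" "a \<noteq> - b" using insert.prems by auto
  then obtain v where v: "cos (2 * pi * (a \<bullet> v)) \<noteq> cos (2 * pi * (b \<bullet> v))"
    using exists_separating_translation by blast
  define T where "T f = (\<lambda>x. f (x - v) + f (x + v) - (2 * cos (2 * pi * (b \<bullet> v))) * f x)"
    for f :: "'a \<Rightarrow> real"
  define r where "r = 2 * cos (2 * pi * (a \<bullet> v)) - 2 * cos (2 * pi * (b \<bullet> v))"
  have "T p = 0" "T h = r *\<^sub>R h"
    using wave_space_symmetrized_translate[OF p, of _ v]
      wave_space_symmetrized_translate[OF insert.prems(1), of _ v]
    by (auto simp: T_def r_def fun_eq_iff algebra_simps)
  moreover have "T (h + g) = T h + T p + T g'"
    by (auto simp: T_def g fun_eq_iff algebra_simps)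
  moreover have "T (h + g) \<in> U"
    unfolding T_def using U insert.prems(3) by (rule translation_invariant_symmetrized)
  ultimately have "r *\<^sub>R h + T g' \<in> U" by simp
  moreover have "T g' \<in> wave_span B"
    unfolding T_def using translation_invariant_wave_span g'
    by (rule translation_invariant_symmetrized)
  moreover have "r *\<^sub>R h \<in> wave_space a"
    using insert.prems(1) by (intro subspace_mul) auto
  \<comment> \<open>With the \<open>b\<close>-component gone, the induction hypothesis applies to
    \<open>r *\<^sub>R h\<close> and \<open>T g'\<close>. Dividing by \<open>r\<close>, nonzero by
    the choice of \<open>v\<close>, recovers \<open>h\<close>.\<close>
  ultimately have "r *\<^sub>R h \<in> U"
    using insert.prems(4,5) insert.IH by blast
  moreover have "subspace U" using U by (simp add: translation_invariant_def)
  ultimately have "(1 / r) *\<^sub>R (r *\<^sub>R h) \<in> U" by (rule subspace_mul[rotated])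
  moreover have "(1 / r) *\<^sub>R (r *\<^sub>R h) = h" using v by (simp add: r_def fun_eq_iff)
  ultimately show ?case by metis
qed

text \<open>The frequencies of \<open>A\<close> are split off one at a time, each against the rest
  of \<open>A\<close> together with \<open>B\<close>. The case \<open>U = {0}\<close> yields linear
  independence.\<close>

lemma wave_span_part_in_invariant:
  assumes U: "translation_invariant U" and "finite A" and B: "finite B"
    and "f \<in> wave_span A" "g \<in> wave_span B" "f + g \<in> U"
    and "\<And>a. a \<in> A \<Longrightarrow> a \<notin> B \<and> - a \<notin> B"
  shows "f \<in> U"
  using assms(2,4-)
proof (induction A arbitrary: f rule: finite_induct)
  case empty
  have "f = 0" using empty.prems(1) by simp
  moreover have "0 \<in> U" using U by (simp add: translation_invariant_def subspace_0)
  ultimately show ?case by metis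
next
  case (insert a A)
  show ?case
  proof (cases "a \<in> A \<or> - a \<in> A")
    \<comment> \<open>Here \<open>a\<close> cannot be separated from \<open>A\<close>, but its wave
      space already lies in \<open>wave_span A\<close>.\<close>
    case True
    then show ?thesis using insert by (simp add: wave_span_insert_redundant)
  next
    case False
    obtain h f' where h: "h \<in> wave_space a" and f': "f' \<in> wave_span A" and f: "f = h + f'"
      using insert.prems(1) by (rule wave_span_insertE)
    have "f' \<in> wave_span (A \<union> B)" "g \<in> wave_span (A \<union> B)"
      using f' insert.prems(2) wave_span_mono[of A "A \<union> B"] wave_span_mono[of B "A \<union> B"] by auto
    then have "f' + g \<in> wave_span (A \<union> B)" by (intro subspace_add) auto
    moreover have "h + (f' + g) \<in> U" using insert.prems(3) unfolding f add.assoc .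
    ultimately have hU: "h \<in> U"
      using wave_component_in_invariant[OF U, of "A \<union> B" h a "f' + g"] h insert.hyps(1) B False
        insert.prems(4)[of a] by auto
    have sub: "subspace U" using U by (simp add: translation_invariant_def)
    have "(f + g) - h \<in> U" using sub insert.prems(3) hU by (rule subspace_diff)
    then have "f' + g \<in> U" by (simp add: f algebra_simps)
    then have "f' \<in> U" using insert.IH[OF f' insert.prems(2)] insert.prems(4) by blast
    then show ?thesis unfolding f by (rule subspace_add[OF sub hU])
  qed
qed

text \<open>For nonzero \<open>a\<close>, translation by a quarter period multiplies the coefficient
  by \<open>- \<i>\<close>, so \<open>h\<close> and its translate span the real plane
  \<open>wave_space a\<close>. For \<open>a = 0\<close> the space is the line of constants.\<close>

lemma wave_space_subset_invariant:
  fixes a :: "'a::real_inner"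
  assumes U: "translation_invariant U" and h: "h \<in> wave_space a" "h \<in> U" "h \<noteq> 0"
  shows "wave_space a \<subseteq> U"
proof
  fix f assume "f \<in> wave_space a"
  then obtain d where f: "f = (\<lambda>u. Re (d * wave a u))" by (elim wave_spaceE)
  obtain c where c: "h = (\<lambda>u. Re (c * wave a u))" using h(1) by (elim wave_spaceE)
  have sub: "subspace U" using U by (simp add: translation_invariant_def)
  show "f \<in> U"
  proof (cases "a = 0")
    case True
    then have "Re c \<noteq> 0" using h(3) by (auto simp: c fun_eq_iff)
    then have "f = (Re d / Re c) *\<^sub>R h" by (simp add: f c True fun_eq_iff)
    then show ?thesis using sub h(2) by (simp add: subspace_mul)
  next
    case False
    have "c \<noteq> 0" using h(3) by (auto simp: c fun_eq_iff)
    define v where "v = (1 / (4 * (a \<bullet> a))) *\<^sub>R a"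
    have "a \<bullet> v = 1 / 4" using False by (simp add: v_def)
    then have "2 * pi * (a \<bullet> v) = pi / 2" by simp
    then have "wave a v = \<i>" by (simp only: wave_eq_cis cis_pi_half)
    then have h': "(\<lambda>x. h (x - v)) = (\<lambda>x. Re (- \<i> * c * wave a x))"
      using wave_add[of a _ "- v"] by (simp add: c wave_uminus algebra_simps fun_eq_iff)
    \<comment> \<open>The translate of \<open>h\<close> is the imaginary part of
      \<open>c * wave a x\<close>, so the real and imaginary parts of \<open>d / c\<close> give the
      coordinates of \<open>f\<close>.\<close>
    have "f x = Re (d / c) * h x + (- Im (d / c)) * h (x - v)" for x
    proof -
      have "f x = Re (d / c * (c * wave a x))" using \<open>c \<noteq> 0\<close> by (simp add: f)
      also have "\<dots> = Re (d / c) * Re (c * wave a x) - Im (d / c) * Im (c * wave a x)"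
        by (simp only: times_complex.sel)
      also have "Im (c * wave a x) = h (x - v)"
        using fun_cong[OF h', of x] by (simp add: mult.assoc times_complex.sel(1)[of \<i>])
      finally show ?thesis by (simp add: c)
    qed
    then have "f = Re (d / c) *\<^sub>R h + (- Im (d / c)) *\<^sub>R (\<lambda>x. h (x - v))"
      by (intro ext) simp
    moreover have "(\<lambda>x. h (x - v)) \<in> U" using U h(2) by (simp add: translation_invariant_def)
    then have "Re (d / c) *\<^sub>R h + (- Im (d / c)) *\<^sub>R (\<lambda>x. h (x - v)) \<in> U"
      using sub h(2) by (intro subspace_add subspace_mul)
    ultimately show ?thesis by metis
  qed
qed

text \<open>Some component of \<open>f\<close> is nonzero; it belongs to \<open>U\<close> by
  separation of frequencies and generates its whole wave space by translations.\<close>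

lemma invariant_contains_wave_space:
  assumes U: "translation_invariant U" and "finite A" "f \<in> wave_span A" "f \<in> U" "f \<noteq> 0"
  shows "\<exists>a\<in>A. wave_space a \<subseteq> U"
  using assms(2-)
proof (induction A arbitrary: f rule: finite_induct)
  case empty
  then show ?case by simp
next
  case (insert a A)
  show ?case
  proof (cases "a \<in> A \<or> - a \<in> A")
    case True
    then show ?thesis using insert by (simp add: wave_span_insert_redundant)
  next
    case False
    obtain h g where h: "h \<in> wave_space a" and g: "g \<in> wave_span A" and f: "f = h + g"
      using insert.prems(1) by (rule wave_span_insertE)
    have "h + g \<in> U" using insert.prems(2) unfolding f .
    then have hU: "h \<in> U"
      using wave_component_in_invariant[OF U insert.hyps(1) h g] False by simp
    show ?thesis
    proof (cases "h = 0")
      case True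
      then have "f = g" by (simp only: f add_0)
      with insert.prems have "g \<in> U" "g \<noteq> 0" by metis+
      then have "\<exists>a\<in>A. wave_space a \<subseteq> U" by (rule insert.IH[OF g])
      then show ?thesis by simp
    next
      case False
      then show ?thesis using wave_space_subset_invariant[OF U h hU] by simp
    qed
  qed
qed

section \<open>Finite direct sums of wave spans\<close>

lemma span_Union_eq_sums:
  fixes S :: "'i \<Rightarrow> 'v::real_vector set"
  assumes "finite I" "\<And>i. i \<in> I \<Longrightarrow> subspace (S i)"
  shows "span (\<Union>i\<in>I. S i) = {\<Sum>i\<in>I. w i | w. \<forall>i\<in>I. w i \<in> S i}" (is "_ = ?R")
proof
  have "subspace ?R"
  proof (rule subspaceI)
    show "0 \<in> ?R" using assms(2) by (auto intro!: exI[of _ "\<lambda>_. 0"] simp: subspace_0)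
  next
    fix x y assume "x \<in> ?R" "y \<in> ?R"
    then obtain w w' where "x = sum w I" "\<forall>i\<in>I. w i \<in> S i" "y = sum w' I" "\<forall>i\<in>I. w' i \<in> S i"
      by auto
    then show "x + y \<in> ?R"
      using assms(2) by (auto intro!: exI[of _ "\<lambda>i. w i + w' i"] simp: sum.distrib subspace_add)
  next
    fix c x assume "x \<in> ?R"
    then obtain w where "x = sum w I" "\<forall>i\<in>I. w i \<in> S i" by auto
    then show "c *\<^sub>R x \<in> ?R"
      using assms(2) by (auto intro!: exI[of _ "\<lambda>i. c *\<^sub>R w i"] simp: scaleR_sum_right subspace_mul)
  qed
  moreover have "(\<Union>i\<in>I. S i) \<subseteq> ?R"
  proof
    fix x assume "x \<in> (\<Union>i\<in>I. S i)"
    then obtain j where "j \<in> I" "x \<in> S j" by auto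
    then show "x \<in> ?R"
      using assms by (auto intro!: exI[of _ "\<lambda>i. if i = j then x else 0"] simp: subspace_0)
  qed
  ultimately show "span (\<Union>i\<in>I. S i) \<subseteq> ?R" by (rule span_minimal[rotated])
next
  show "?R \<subseteq> span (\<Union>i\<in>I. S i)" by (auto intro!: span_sum intro: span_base)
qed

text \<open>When a sum vanishes, each summand is separated from the others by
  \<open>wave_span_part_in_invariant\<close> with \<open>U = {0}\<close>. Disjointness up to sign is
  required since opposite frequencies share a wave space.\<close>

lemma is_direct_sum_wave_span:
  assumes I: "finite I" and fin: "\<And>i. i \<in> I \<Longrightarrow> finite (S i)"
    and disj: "\<And>i j a. i \<in> I \<Longrightarrow> j \<in> I \<Longrightarrow> i \<noteq> j \<Longrightarrow> a \<in> S i \<Longrightarrow> a \<notin> S j \<and> - a \<notin> S j"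
  shows "is_direct_sum I (\<lambda>i. wave_span (S i)) (wave_span (\<Union>i\<in>I. S i))"
proof -
  have "wave_span (\<Union>i\<in>I. S i) = span (\<Union>i\<in>I. wave_span (S i))"
  proof
    have "wave_space u \<subseteq> span (\<Union>i\<in>I. wave_span (S i))" if u: "u \<in> (\<Union>i\<in>I. S i)" for u
    proof -
      obtain i where "i \<in> I" "u \<in> S i" using u by blast
      then have "wave_space u \<subseteq> (\<Union>i\<in>I. wave_span (S i))"
        using wave_space_subset_wave_span by blast
      then show ?thesis using span_superset by (rule subset_trans)
    qed
    then show "wave_span (\<Union>i\<in>I. S i) \<subseteq> span (\<Union>i\<in>I. wave_span (S i))"
      by (rule wave_span_subset[OF subspace_span])
    show "span (\<Union>i\<in>I. wave_span (S i)) \<subseteq> wave_span (\<Union>i\<in>I. S i)"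
      by (intro span_minimal subspace_wave_span UN_least wave_span_mono) auto
  qed
  then have "wave_span (\<Union>i\<in>I. S i) = {\<Sum>i\<in>I. w i | w. \<forall>i\<in>I. w i \<in> wave_span (S i)}"
    using span_Union_eq_sums[OF I, of "\<lambda>i. wave_span (S i)"] by simp
  moreover have "w i = 0" if w: "\<forall>i\<in>I. w i \<in> wave_span (S i)" "(\<Sum>i\<in>I. w i) = 0" and i: "i \<in> I"
    for w i
  proof -
    let ?B = "\<Union>j\<in>I - {i}. S j"
    have "w j \<in> wave_span ?B" if "j \<in> I - {i}" for j
      using w(1) that wave_span_mono[of "S j" ?B] by blast
    then have "(\<Sum>j\<in>I - {i}. w j) \<in> wave_span ?B" by (intro subspace_sum) auto
    moreover have "w i + (\<Sum>j\<in>I - {i}. w j) \<in> {0}"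
      using w(2) I i by (simp add: sum.remove)
    moreover have "finite ?B" using I fin by simp
    moreover have "a \<notin> ?B \<and> - a \<notin> ?B" if "a \<in> S i" for a
      using disj[OF i _ _ that] by blast
    moreover have "w i \<in> wave_span (S i)" using w(1) i by blast
    ultimately have "w i \<in> {0}"
      using wave_span_part_in_invariant[OF translation_invariant_zero fin[OF i]] by metis
    then show ?thesis by simp
  qed
  ultimately show ?thesis
    unfolding is_direct_sum_def using I subspace_wave_span by blast
qed


section \<open>Decomposition into irreducible subspaces\<close>

lemma periodic_spaceI:
  assumes "\<And>l u. l \<in> \<Lambda> \<Longrightarrow> f (u + l) = f u"
    and "\<And>u. ((\<lambda>k. c k * wave k u) has_sum complex_of_real (f u)) (dual \<Lambda>)"
  shows "f \<in> periodic_space \<Lambda>"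
  unfolding periodic_space_def mem_Collect_eq using assms by meson

lemma periodic_spaceE:
  assumes "f \<in> periodic_space \<Lambda>"
  obtains c where "\<And>l u. l \<in> \<Lambda> \<Longrightarrow> f (u + l) = f u"
    and "\<And>u. ((\<lambda>k. c k * wave k u) has_sum complex_of_real (f u)) (dual \<Lambda>)"
  using assms unfolding periodic_space_def mem_Collect_eq by meson

lemma subspace_periodic_space: "subspace (periodic_space \<Lambda>)"
proof (rule subspaceI)
  show "0 \<in> periodic_space \<Lambda>" by (rule periodic_spaceI[of _ _ "\<lambda>_. 0"]) simp_all
next
  fix f g assume "f \<in> periodic_space \<Lambda>" "g \<in> periodic_space \<Lambda>"
  then obtain c d where f: "\<And>l u. l \<in> \<Lambda> \<Longrightarrow> f (u + l) = f u"
      "\<And>u. ((\<lambda>k. c k * wave k u) has_sum complex_of_real (f u)) (dual \<Lambda>)"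
    and g: "\<And>l u. l \<in> \<Lambda> \<Longrightarrow> g (u + l) = g u"
      "\<And>u. ((\<lambda>k. d k * wave k u) has_sum complex_of_real (g u)) (dual \<Lambda>)"
    by (elim periodic_spaceE) (rule that)
  have "((\<lambda>k. (c k + d k) * wave k u) has_sum complex_of_real ((f + g) u)) (dual \<Lambda>)" for u
    using has_sum_add[OF f(2)[of u] g(2)[of u]] by (simp add: distrib_right)
  then show "f + g \<in> periodic_space \<Lambda>"
    using f(1) g(1) by (intro periodic_spaceI[of _ _ "\<lambda>k. c k + d k"]) simp_all
next
  fix r f assume "f \<in> periodic_space \<Lambda>"
  then obtain c where f: "\<And>l u. l \<in> \<Lambda> \<Longrightarrow> f (u + l) = f u"
      "\<And>u. ((\<lambda>k. c k * wave k u) has_sum complex_of_real (f u)) (dual \<Lambda>)"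
    by (elim periodic_spaceE) (rule that)
  have "((\<lambda>k. (of_real r * c k) * wave k u) has_sum complex_of_real ((r *\<^sub>R f) u)) (dual \<Lambda>)" for u
    using has_sum_cmult_right[OF f(2)[of u], of "of_real r"] by (simp add: mult.assoc)
  then show "r *\<^sub>R f \<in> periodic_space \<Lambda>"
    using f(1) by (intro periodic_spaceI[of _ _ "\<lambda>k. of_real r * c k"]) simp_all
qed

lemma wave_space_subset_periodic_space:
  assumes "k \<in> dual \<Lambda>"
  shows "wave_space k \<subseteq> periodic_space \<Lambda>"
proof
  fix f assume "f \<in> wave_space k"
  then obtain c where f: "f = (\<lambda>u. Re (c * wave k u))" by (elim wave_spaceE)
  have k': "- k \<in> dual \<Lambda>" using assms by (simp add: dual_def)
  have single: "((\<lambda>k. (if k = a then d else 0) * wave k u) has_sum d * wave a u) (dual \<Lambda>)"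
    if "a \<in> dual \<Lambda>" for a u and d :: complex
    using that by (intro has_sum_finite_neutralI[of "{a}"]) auto
  \<comment> \<open>The two halves of the real part are separate summands, so that for
    \<open>k = 0\<close> the coefficients at \<open>k\<close> and \<open>- k\<close> add up.\<close>
  have "((\<lambda>j. ((if j = k then c / 2 else 0) + (if j = - k then cnj c / 2 else 0)) * wave j u)
      has_sum complex_of_real (f u)) (dual \<Lambda>)" for u
  proof -
    have "c / 2 * wave k u + cnj c / 2 * wave (- k) u = complex_of_real (f u)"
      using complex_add_cnj[of "c * wave k u"] by (simp add: f wave_uminus field_simps)
    then show ?thesis
      using has_sum_add[OF single[OF assms, of "c / 2" u] single[OF k', of "cnj c / 2" u]]
      by (simp add: distrib_right)
  qed
  moreover have "f (u + l) = f u" if "l \<in> \<Lambda>" for u l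
    using assms that wave_eq_1_iff[of k l] by (simp add: f wave_add dual_def)
  ultimately show "f \<in> periodic_space \<Lambda>" by (rule periodic_spaceI[rotated])
qed

text \<open>Abstracts from the projected lattice and holohedry what the orbit argument uses: a group
  \<open>J\<close> of orthogonal maps acting on frequencies in
  \<open>dual \<Lambda>\<close>.\<close>

locale orthogonal_symmetry =
  fixes \<Lambda> :: "'a::euclidean_space set" and J :: "('a \<Rightarrow> 'a) set"
  assumes zero_in: "0 \<in> \<Lambda>"
    and orth: "\<alpha> \<in> J \<Longrightarrow> orthogonal_transformation \<alpha>"
    and id_in: "id \<in> J"
    and comp_in: "\<alpha> \<in> J \<Longrightarrow> \<beta> \<in> J \<Longrightarrow> \<alpha> \<circ> \<beta> \<in> J"
    and inv_in: "\<alpha> \<in> J \<Longrightarrow> inv_into UNIV \<alpha> \<in> J"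
begin

abbreviation invariant where
  "invariant \<equiv> invariant_subspace (symmetry_group \<Lambda> J) sym_act (periodic_space \<Lambda>)"

abbreviation irreducible where
  "irreducible \<equiv> irreducible_subspace (symmetry_group \<Lambda> J) sym_act (periodic_space \<Lambda>)"

text \<open>Both signs are included because \<open>u\<close> and \<open>- u\<close> give the same
  wave space: this is an orbit of pairs of opposite vectors.\<close>

definition orbit :: "'a \<Rightarrow> 'a set"
  where "orbit u = {\<alpha> u | \<alpha>. \<alpha> \<in> J} \<union> {- \<alpha> u | \<alpha>. \<alpha> \<in> J}"

section \<open>Signed orbits as equivalence classes\<close>

lemma self_in_orbit: "u \<in> orbit u"
  using id_in by (force simp: orbit_def)

lemma uminus_in_orbit: "w \<in> orbit u \<Longrightarrow> - w \<in> orbit u"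
  by (auto simp: orbit_def)

lemma apply_in_orbit:
  assumes "\<alpha> \<in> J" "w \<in> orbit u"
  shows "\<alpha> w \<in> orbit u"
proof -
  obtain \<beta> where \<beta>: "\<beta> \<in> J" "w = \<beta> u \<or> w = - \<beta> u" using assms(2) by (auto simp: orbit_def)
  have "linear \<alpha>" using assms(1) orth by (simp add: orthogonal_transformation_def)
  then have "\<alpha> w = (\<alpha> \<circ> \<beta>) u \<or> \<alpha> w = - (\<alpha> \<circ> \<beta>) u"
    using \<beta>(2) by (auto simp: linear_neg)
  then show ?thesis using comp_in[OF assms(1) \<beta>(1)] unfolding orbit_def by blast
qed

lemma orbit_subset: "w \<in> orbit u \<Longrightarrow> orbit w \<subseteq> orbit u"
  using apply_in_orbit uminus_in_orbit by (auto simp: orbit_def[of w])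

lemma orbit_sym:
  assumes "w \<in> orbit u"
  shows "u \<in> orbit w"
proof -
  obtain \<beta> where \<beta>: "\<beta> \<in> J" "w = \<beta> u \<or> w = - \<beta> u" using assms by (auto simp: orbit_def)
  have "linear (inv_into UNIV \<beta>)" "inv_into UNIV \<beta> (\<beta> u) = u"
    using inv_in[OF \<beta>(1)] orth \<beta>(1) orthogonal_transformation_inj[of \<beta>]
    by (auto simp: orthogonal_transformation_def)
  then have "inv_into UNIV \<beta> w = u \<or> - inv_into UNIV \<beta> w = u" using \<beta>(2) by (auto simp: linear_neg)
  then show ?thesis using inv_in[OF \<beta>(1)] unfolding orbit_def by blast
qed

lemma orbit_eq: "w \<in> orbit u \<Longrightarrow> orbit w = orbit u"
  using orbit_subset orbit_sym by blast

lemma norm_orbit: "w \<in> orbit u \<Longrightarrow> norm w = norm u"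
  using orth by (auto simp: orbit_def orthogonal_transformation)

text \<open>Orthogonality moves the inverse of \<open>\<delta>\<close> across the inner product onto
  \<open>u\<close>, and the translation leaves only a phase. That phase keeps the chosen coset
  representative visible.\<close>

lemma sym_act_wave:
  assumes "\<delta> \<in> J"
  shows "sym_act (A, \<delta>) (\<lambda>x. Re (c * wave u x)) =
    (\<lambda>x. Re (c * wave (\<delta> u) (- (SOME v. v \<in> A)) * wave (\<delta> u) x))"
proof -
  define v where "v = (SOME v. v \<in> A)"
  have "wave u (inv_into UNIV \<delta> y) = wave (\<delta> u) y" for y
  proof -
    have "y = \<delta> (inv_into UNIV \<delta> y)"
      using orthogonal_transformation_surj[OF orth[OF assms]] by (simp add: surj_f_inv_f)
    then have "\<delta> u \<bullet> y = u \<bullet> inv_into UNIV \<delta> y"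
      using orth[OF assms] by (metis orthogonal_transformation_def)
    then show ?thesis by (simp add: wave_def)
  qed
  then show ?thesis
    using wave_add[of "\<delta> u" _ "- v"]
    by (simp add: sym_act_def v_def[symmetric] ac_simps)
qed

section \<open>Subspaces invariant under the symmetry group\<close>

lemma carrier_Gamma: "carrier (symmetry_group \<Lambda> J) = range (\<lambda>v. (\<lambda>l. l + v) ` \<Lambda>) \<times> J"
  by (simp add: symmetry_group_def carrier_translation_quotient)

text \<open>Cosets paired with \<open>id\<close> act as translations, the representative being
  immaterial on periodic functions. This brings in the separation of frequencies.\<close>

lemma invariant_imp_translation_invariant:
  assumes "invariant U"
  shows "translation_invariant U"
  unfolding translation_invariant_def
proof (intro conjI ballI allI)
  show "subspace U" using assms by (simp add: invariant_subspace_def)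
next
  fix f v assume f: "f \<in> U"
  have "sym_act ((\<lambda>l. l + v) ` \<Lambda>, id) f \<in> U"
    using assms f id_in unfolding invariant_subspace_def carrier_Gamma by blast
  moreover have "f \<in> periodic_space \<Lambda>" using assms f by (auto simp: invariant_subspace_def)
  then have "sym_act ((\<lambda>l. l + v) ` \<Lambda>, id) f u = f (u - v)" for u
    using sym_act_coset[of f \<Lambda> id v u] zero_in linear_id by auto
  then have "sym_act ((\<lambda>l. l + v) ` \<Lambda>, id) f = (\<lambda>x. f (x - v))" by (simp add: fun_eq_iff)
  ultimately show "(\<lambda>x. f (x - v)) \<in> U" by simp
qed

lemma invariant_wave_span:
  assumes "S \<subseteq> dual \<Lambda>" "\<And>\<alpha> u. \<alpha> \<in> J \<Longrightarrow> u \<in> S \<Longrightarrow> \<alpha> u \<in> S"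
  shows "invariant (wave_span S)"
  unfolding invariant_subspace_def
proof (intro conjI ballI)
  show "wave_span S \<subseteq> periodic_space \<Lambda>"
    using assms(1) by (intro wave_span_subset subspace_periodic_space
        wave_space_subset_periodic_space) auto
next
  fix g assume "g \<in> carrier (symmetry_group \<Lambda> J)"
  then obtain A \<delta> where g: "g = (A, \<delta>)" "\<delta> \<in> J" by (auto simp: carrier_Gamma)
  show "sym_act g ` wave_span S \<subseteq> wave_span S"
  proof (rule wave_span_linear_image)
    show "linear (sym_act g)"
      unfolding sym_act_def g(1) by (simp add: linear_precomp)
  next
    fix u f assume u: "u \<in> S" and "f \<in> wave_space u"
    then have "sym_act g f \<in> wave_space (\<delta> u)"
      by (auto simp: g(1) sym_act_wave[OF g(2)] elim!: wave_spaceE)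
    then show "sym_act g f \<in> wave_span S"
      using wave_space_subset_wave_span[OF assms(2)[OF g(2) u]] by blast
  qed
qed simp

text \<open>One nonzero function of \<open>wave_space (\<alpha> u)\<close> inside \<open>U\<close>
  suffices; the image of a cosine wave under \<open>\<alpha>\<close> is one.\<close>

lemma invariant_apply_wave_space:
  assumes U: "invariant U" and u: "wave_space u \<subseteq> U" and \<alpha>: "\<alpha> \<in> J"
  shows "wave_space (\<alpha> u) \<subseteq> U"
proof -
  define f where "f = (\<lambda>x. Re (1 * wave u x))"
  define A where "A = (\<lambda>l. l + 0) ` \<Lambda>"
  define v where "v = (SOME v. v \<in> A)"
  define g where "g = sym_act (A, \<alpha>) f"
  have g: "g = (\<lambda>x. Re (wave (\<alpha> u) (- v) * wave (\<alpha> u) x))"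
    unfolding g_def f_def sym_act_wave[OF \<alpha>] v_def by simp
  have "f \<in> U" using u unfolding f_def by blast
  then have "g \<in> U"
    using U \<alpha> unfolding g_def A_def invariant_subspace_def carrier_Gamma by blast
  moreover have "g \<in> wave_space (\<alpha> u)" by (auto simp: g)
  \<comment> \<open>The representative \<open>v\<close> of the zero coset may be nonzero; evaluating
    at \<open>v\<close> cancels the phase it causes.\<close>
  moreover have "g v = 1"
    using wave_add[of "\<alpha> u" "- v" v] by (simp add: g)
  then have "g \<noteq> 0" by auto
  ultimately show ?thesis
    using wave_space_subset_invariant[OF invariant_imp_translation_invariant[OF U]] by blast
qed

text \<open>Translations force a nonzero invariant subspace to contain one wave space of the orbit;
  \<open>J\<close> then carries it to all the others.\<close>

lemma irreducible_wave_span_orbit: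
  assumes "finite (orbit u)" "orbit u \<subseteq> dual \<Lambda>"
  shows "irreducible (wave_span (orbit u))"
  unfolding irreducible_subspace_def
proof (intro conjI allI impI)
  show "invariant (wave_span (orbit u))"
    using assms(2) apply_in_orbit by (intro invariant_wave_span)
next
  fix U assume U: "invariant U \<and> U \<subseteq> wave_span (orbit u)"
  then have tU: "translation_invariant U" by (simp add: invariant_imp_translation_invariant)
  show "U = {0} \<or> U = wave_span (orbit u)"
  proof (cases "U = {0}")
    case False
    moreover have "0 \<in> U" using U by (simp add: invariant_subspace_def subspace_0)
    ultimately obtain f where "f \<in> U" "f \<noteq> 0" by auto
    then obtain a where a: "a \<in> orbit u" "wave_space a \<subseteq> U"
      using invariant_contains_wave_space[OF tU assms(1)] U by blast
    have "wave_space w \<subseteq> U" if "w \<in> orbit u" for w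
    proof -
      have "w \<in> orbit a" using that orbit_eq[OF a(1)] by simp
      then obtain \<alpha> where "\<alpha> \<in> J" "w = \<alpha> a \<or> w = - \<alpha> a" by (auto simp: orbit_def)
      then show ?thesis
        using invariant_apply_wave_space[OF _ a(2)] U wave_space_uminus by metis
    qed
    then have "wave_span (orbit u) \<subseteq> U"
      using U by (intro wave_span_subset) (auto simp: invariant_subspace_def)
    then show ?thesis using U by blast
  qed simp
qed

text \<open>\<open>P\<close> splits into signed orbits, one irreducible summand each. Norms are
  constant on orbits, so \<open>u1\<close> and \<open>u2\<close> lie in different ones.\<close>

lemma mode_interaction_wave_span:
  assumes P: "finite P" "P \<subseteq> dual \<Lambda>"
    and J: "\<And>\<alpha> u. \<alpha> \<in> J \<Longrightarrow> u \<in> P \<Longrightarrow> \<alpha> u \<in> P" and neg: "\<And>u. u \<in> P \<Longrightarrow> - u \<in> P"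
    and u: "u1 \<in> P" "u2 \<in> P" "norm u1 \<noteq> norm u2"
  shows "mode_interaction (symmetry_group \<Lambda> J) sym_act (periodic_space \<Lambda>) (wave_span P)"
proof -
  have orbit_P: "orbit u \<subseteq> P" if "u \<in> P" for u
    using that J neg by (auto simp: orbit_def)
  define C where "C = orbit ` P"
  have UC: "\<Union>C = P" using orbit_P self_in_orbit by (auto simp: C_def)
  have finC: "finite C" using P(1) by (simp add: C_def)
  define r where "r = card C"
  obtain S where S: "bij_betw S {..<r} C"
    using ex_bij_betw_nat_finite[OF finC] by (auto simp: r_def lessThan_atLeast0)
  have "orbit u1 \<noteq> orbit u2"
    using norm_orbit[of u1 u2] self_in_orbit[of u1] u(3) by auto
  then have "card {orbit u1, orbit u2} = 2" by simp
  moreover have "card {orbit u1, orbit u2} \<le> r"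
    unfolding r_def using u finC by (intro card_mono) (auto simp: C_def)
  ultimately have "r > 1" by simp
  have S_orbit: "\<exists>u\<in>P. S i = orbit u" if "i < r" for i
    using that bij_betwE[OF S] unfolding C_def by blast
  have "is_direct_sum {..<r} (\<lambda>i. wave_span (S i)) (wave_span (\<Union>i\<in>{..<r}. S i))"
  proof (rule is_direct_sum_wave_span)
    fix i assume "i \<in> {..<r}"
    then show "finite (S i)"
      using S_orbit[of i] orbit_P finite_subset[OF _ P(1)] by auto
  next
    fix i j a assume i: "i \<in> {..<r}" and j: "j \<in> {..<r}" and ij: "i \<noteq> j" and a: "a \<in> S i"
    have "S i \<noteq> S j"
      using bij_betw_imp_inj_on[OF S] i j ij by (auto dest: inj_onD)
    moreover obtain u u' where u: "S i = orbit u" "S j = orbit u'"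
      using S_orbit[of i] S_orbit[of j] i j by auto
    \<comment> \<open>Distinct orbits are disjoint, and each is closed under negation, which settles
      \<open>- a\<close> as well.\<close>
    ultimately have "b \<notin> S j" if "b \<in> S i" for b
      using orbit_eq[of b u] orbit_eq[of b u'] that by auto
    moreover have "- a \<in> S i" using u(1) a uminus_in_orbit by simp
    ultimately show "a \<notin> S j \<and> - a \<notin> S j" using a by blast
  qed simp
  moreover have "(\<Union>i\<in>{..<r}. S i) = P" using S UC by (simp add: bij_betw_def)
  moreover have "wave_span (S i) \<noteq> {0} \<and> irreducible (wave_span (S i))" if i: "i < r" for i
  proof -
    obtain u where u: "u \<in> P" "S i = orbit u" using S_orbit[OF i] by blast
    have "wave_space u \<subseteq> wave_span (orbit u)"
      by (intro wave_space_subset_wave_span self_in_orbit)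
    then have "wave_span (orbit u) \<noteq> {0}"
      using wave_space_nontrivial[of u] subspace_0[OF subspace_wave_space, of u] by blast
    moreover have "irreducible (wave_span (orbit u))"
      using orbit_P[OF u(1)] P finite_subset by (intro irreducible_wave_span_orbit) blast+
    ultimately show ?thesis by (simp add: u(2))
  qed
  ultimately show ?thesis
    unfolding mode_interaction_def
    by (intro exI[of _ r] conjI exI[of _ "\<lambda>i. wave_span (S i)"] \<open>r > 1\<close>) simp_all
qed

end


section \<open>Projection of waves\<close>

text \<open>For nonzero \<open>z\<close> the integral is \<open>wave z y0 - 1\<close> divided by the
  rate of the exponential, which is zero only for integral \<open>z * y0\<close>. For
  \<open>z = 0\<close> it is \<open>y0\<close>.\<close>

lemma has_integral_wave:
  fixes z y0 :: real
  assumes "0 < y0" "z \<noteq> 0 \<Longrightarrow> z * y0 \<notin> \<int>"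
  shows "\<exists>I. I \<noteq> 0 \<and> (wave z has_integral I) {0..y0}"
proof (cases "z = 0")
  case True
  then have "wave z = (\<lambda>_. 1)" by (simp add: fun_eq_iff)
  then show ?thesis
    using has_integral_const_real[of "1::complex" 0 y0] assms(1)
    by (intro exI[of _ "of_real y0"]) (auto simp: scaleR_conv_of_real)
next
  case False
  define q where "q = 2 * complex_of_real pi * \<i> * of_real z"
  have "q \<noteq> 0" using False by (simp add: q_def)
  have wave: "wave z y = exp (of_real y * q)" for y
    by (simp add: wave_def q_def mult.commute mult.left_commute)
  have "((\<lambda>w. exp (w * q) / q) has_field_derivative exp (of_real y * q)) (at (of_real y))" for y
    using \<open>q \<noteq> 0\<close> by (auto intro!: derivative_eq_intros)
  then have "((\<lambda>y. exp (of_real y * q)) has_integral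
      exp (of_real y0 * q) / q - exp (of_real 0 * q) / q) {0..y0}"
    using assms(1) by (intro fundamental_theorem_of_calculus has_vector_derivative_real_field) auto
  then have "(wave z has_integral (wave z y0 - 1) / q) {0..y0}"
    unfolding wave[abs_def] by (simp add: diff_divide_distrib)
  moreover have "wave z y0 \<noteq> 1" using assms(2)[OF False] by (simp add: wave_eq_1_iff)
  ultimately show ?thesis using \<open>q \<noteq> 0\<close> by (intro exI[of _ "(wave z y0 - 1) / q"]) auto
qed

text \<open>Waves factor over the two coordinates, so integration only multiplies \<open>c\<close>
  by a constant. Integrability is recorded to let \<open>proj\<close> pass through finite
  sums.\<close>

lemma has_integral_wave_space:
  assumes "f \<in> wave_space k" "0 < y0" "snd k \<noteq> 0 \<Longrightarrow> snd k * y0 \<notin> \<int>"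
  shows "(\<lambda>y. f (x, y)) integrable_on {0..y0}" "proj y0 f \<in> wave_space (fst k)"
proof -
  obtain u z where k: "k = (u, z)" by force
  obtain I where I: "(wave z has_integral I) {0..y0}"
    using has_integral_wave[of y0 z] assms by (auto simp: k)
  obtain c where f: "f = (\<lambda>u. Re (c * wave k u))" using assms(1) by (elim wave_spaceE)
  have *: "((\<lambda>y. f (x, y)) has_integral Re (c * I * wave u x)) {0..y0}" for x
    using has_integral_linear[OF has_integral_mult_right[OF I, of "c * wave u x"] bounded_linear_Re]
    by (simp add: f k wave_pair o_def mult.assoc mult.commute mult.left_commute)
  then show "(\<lambda>y. f (x, y)) integrable_on {0..y0}" by (rule has_integral_integrable)
  have "proj y0 f = (\<lambda>x. Re (c * I * wave u x))"
    unfolding proj_def using integral_unique[OF *] by (rule ext)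
  then show "proj y0 f \<in> wave_space (fst k)" using wave_spaceI[of "c * I" u] by (simp add: k)
qed

lemma proj_wave_space:
  assumes "0 < y0" "snd k \<noteq> 0 \<Longrightarrow> snd k * y0 \<notin> \<int>"
  shows "proj y0 ` wave_space k = wave_space (fst k)"
proof
  show "proj y0 ` wave_space k \<subseteq> wave_space (fst k)"
    using has_integral_wave_space(2)[OF _ assms] by auto
next
  obtain u z where k: "k = (u, z)" by force
  obtain I where I: "I \<noteq> 0" "(wave z has_integral I) {0..y0}"
    using has_integral_wave[of y0 z] assms by (auto simp: k)
  show "wave_space (fst k) \<subseteq> proj y0 ` wave_space k"
  proof
    fix f assume "f \<in> wave_space (fst k)"
    then obtain c where f: "f = (\<lambda>x. Re (c * wave u x))" by (auto simp: k elim: wave_spaceE)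
    \<comment> \<open>Dividing by \<open>I\<close> compensates the factor that integration
      produces.\<close>
    define g where "g = (\<lambda>x. Re (c / I * wave k x))"
    have "((\<lambda>y. g (x, y)) has_integral f x) {0..y0}" for x
      using has_integral_linear[OF has_integral_mult_right[OF I(2), of "c / I * wave u x"]
          bounded_linear_Re] I(1)
      by (simp add: f g_def k wave_pair o_def mult.assoc mult.commute mult.left_commute)
    then have "proj y0 g = f" unfolding proj_def by (intro ext integral_unique)
    moreover have "g \<in> wave_space k" unfolding g_def by (rule wave_spaceI)
    ultimately show "f \<in> proj y0 ` wave_space k" by blast
  qed
qed

text \<open>Elements of \<open>K\<close> may have equal or opposite first components, so the
  projected sum can lose directness; hence a span on the right.\<close>

lemma proj_direct_sum_wave_space:
  assumes V: "is_direct_sum K wave_space V"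
    and y0: "0 < y0" "\<And>k. k \<in> K \<Longrightarrow> snd k \<noteq> 0 \<Longrightarrow> snd k * y0 \<notin> \<int>"
  shows "proj y0 ` V = wave_span (fst ` K)"
proof -
  have fin: "finite K"
    using V unfolding is_direct_sum_def by (elim conjE)
  have Veq: "V = {\<Sum>k\<in>K. w k | w. \<forall>k\<in>K. w k \<in> wave_space k}"
    using V unfolding is_direct_sum_def by (elim conjE)
  have proj_sum: "proj y0 (\<Sum>k\<in>K. w k) = (\<Sum>k\<in>K. proj y0 (w k))"
    if w: "\<forall>k\<in>K. w k \<in> wave_space k" for w
  proof
    fix x
    have "(\<lambda>y. w k (x, y)) integrable_on {0..y0}" if "k \<in> K" for k
      using w that has_integral_wave_space(1)[OF _ y0(1) y0(2)[OF that]] by blast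
    then have "integral {0..y0} (\<lambda>y. \<Sum>k\<in>K. w k (x, y)) =
        (\<Sum>k\<in>K. integral {0..y0} (\<lambda>y. w k (x, y)))"
      by (rule integral_sum[OF fin])
    then show "proj y0 (\<Sum>k\<in>K. w k) x = (\<Sum>k\<in>K. proj y0 (w k)) x"
      by (simp add: proj_def)
  qed
  \<comment> \<open>The sums stay indexed by \<open>K\<close>; passing to the span afterwards merges
    coinciding frequencies.\<close>
  have "proj y0 ` V = {\<Sum>k\<in>K. w k | w. \<forall>k\<in>K. w k \<in> wave_space (fst k)}" (is "_ = ?R")
  proof
    show "proj y0 ` V \<subseteq> ?R"
    proof
      fix g assume "g \<in> proj y0 ` V"
      then obtain f where f: "f \<in> V" "g = proj y0 f" by (elim imageE) (rule that)
      obtain w where w: "f = (\<Sum>k\<in>K. w k)" "\<forall>k\<in>K. w k \<in> wave_space k"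
        using f(1) unfolding Veq by (elim CollectE exE conjE) (rule that)
      have "\<forall>k\<in>K. proj y0 (w k) \<in> wave_space (fst k)"
        using w(2) has_integral_wave_space(2)[OF _ y0(1) y0(2)] by metis
      then show "g \<in> ?R"
        unfolding f(2) w(1) proj_sum[OF w(2)]
        by (intro CollectI exI[of _ "\<lambda>k. proj y0 (w k)"] conjI refl)
    qed
    show "?R \<subseteq> proj y0 ` V"
    proof
      fix g assume "g \<in> ?R"
      then obtain w where w: "g = (\<Sum>k\<in>K. w k)" "\<forall>k\<in>K. w k \<in> wave_space (fst k)"
        by (elim CollectE exE conjE) (rule that)
      have "\<forall>k\<in>K. \<exists>f. f \<in> wave_space k \<and> proj y0 f = w k"
      proof
        fix k assume k: "k \<in> K"
        show "\<exists>f. f \<in> wave_space k \<and> proj y0 f = w k"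
          using proj_wave_space[OF y0(1) y0(2)[OF k]] w(2) k by (metis image_iff)
      qed
      from bchoice[OF this] obtain h
        where h: "\<forall>k\<in>K. h k \<in> wave_space k \<and> proj y0 (h k) = w k" by (rule exE)
      then have "proj y0 (\<Sum>k\<in>K. h k) = (\<Sum>k\<in>K. proj y0 (h k))" by (intro proj_sum) simp
      also have "\<dots> = g" unfolding w(1) using h by (intro sum.cong) simp_all
      finally have "g = proj y0 (\<Sum>k\<in>K. h k)" by (rule sym)
      moreover have "(\<Sum>k\<in>K. h k) \<in> V"
        unfolding Veq using h by (intro CollectI exI[of _ h] conjI refl) simp
      ultimately show "g \<in> proj y0 ` V" by (rule image_eqI)
    qed
  qed
  also have "\<dots> = span (\<Union>k\<in>K. wave_space (fst k))"
    by (rule span_Union_eq_sums[OF fin, symmetric]) simp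
  finally show ?thesis by (simp add: wave_span_def image_image)
qed


section \<open>Symmetries of the projection\<close>

lemma holohedry_comp:
  assumes "\<gamma> \<in> holohedry L" "\<delta> \<in> holohedry L"
  shows "\<gamma> \<circ> \<delta> \<in> holohedry L"
proof -
  have "(\<gamma> \<circ> \<delta>) ` L = \<gamma> ` (\<delta> ` L)" by (simp only: image_comp)
  then show ?thesis
    using assms by (simp add: holohedry_def orthogonal_transformation_compose)
qed

text \<open>Stated for any pointwise left inverse, so that it applies directly to a
  \<open>map_prod\<close> of inverses.\<close>

lemma holohedry_inverse:
  assumes "\<gamma> \<in> holohedry L" "\<And>x. \<delta> (\<gamma> x) = x"
  shows "\<delta> \<in> holohedry L"
proof -
  have \<gamma>: "orthogonal_transformation \<gamma>" "\<gamma> ` L = L" using assms(1) by (auto simp: holohedry_def)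
  have "\<delta> = inv_into UNIV \<gamma>"
    using assms(2) orthogonal_transformation_surj[OF \<gamma>(1)]
    by (metis surj_f_inv_f ext)
  moreover have "\<delta> ` L = L"
  proof -
    have "\<delta> ` \<gamma> ` L = L" using assms(2) by (simp add: image_image)
    then show ?thesis by (simp only: \<gamma>(2))
  qed
  ultimately show ?thesis
    using orthogonal_transformation_inv[OF \<gamma>(1)] by (simp add: holohedry_def)
qed

lemma holohedry_orbit_closed:
  assumes "\<gamma> \<in> holohedry L" "l \<in> holohedry_orbit L k"
  shows "\<gamma> l \<in> holohedry_orbit L k"
  using assms holohedry_comp[OF assms(1)] unfolding holohedry_orbit_def
  by (smt (verit) comp_apply mem_Collect_eq)

lemma norm_holohedry_orbit: "l \<in> holohedry_orbit L k \<Longrightarrow> norm l = norm k"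
  by (auto simp: holohedry_orbit_def holohedry_def orthogonal_transformation)

lemma id_in_proj_holohedry: "id \<in> proj_holohedry y0 L"
  by (auto simp: proj_holohedry_def holohedry_def map_prod.identity id_def)

text \<open>The signs on the last coordinate multiply. If the product is negative, the factor with
  sign -1 supplies \<open>(0, y0) \<in> L\<close>.\<close>

lemma proj_holohedry_comp:
  assumes "\<alpha> \<in> proj_holohedry y0 L" "\<beta> \<in> proj_holohedry y0 L"
  shows "\<alpha> \<circ> \<beta> \<in> proj_holohedry y0 L"
proof -
  have eqs: "map_prod (\<alpha> \<circ> \<beta>) (id :: real \<Rightarrow> real) = map_prod \<alpha> id \<circ> map_prod \<beta> id"
    "map_prod (\<alpha> \<circ> \<beta>) (id :: real \<Rightarrow> real) = map_prod \<alpha> uminus \<circ> map_prod \<beta> uminus"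
    "map_prod (\<alpha> \<circ> \<beta>) (uminus :: real \<Rightarrow> real) = map_prod \<alpha> id \<circ> map_prod \<beta> uminus"
    "map_prod (\<alpha> \<circ> \<beta>) (uminus :: real \<Rightarrow> real) = map_prod \<alpha> uminus \<circ> map_prod \<beta> id"
    by (auto simp: fun_eq_iff)
  show ?thesis
    using assms unfolding proj_holohedry_def
    by (auto simp: orthogonal_transformation_compose)
      (metis eqs holohedry_comp)+
qed

lemma proj_holohedry_inv:
  assumes "\<alpha> \<in> proj_holohedry y0 L"
  shows "inv_into UNIV \<alpha> \<in> proj_holohedry y0 L"
proof -
  have \<alpha>: "orthogonal_transformation \<alpha>" using assms by (simp add: proj_holohedry_def)
  have inv: "inv_into UNIV \<alpha> (\<alpha> x) = x" for x
    using orthogonal_transformation_inj[OF \<alpha>] by simp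
  \<comment> \<open>\<open>h\<close> stands for \<open>id\<close> or \<open>uminus\<close>, both
    involutions.\<close>
  have "map_prod (inv_into UNIV \<alpha>) h \<in> holohedry L" if "map_prod \<alpha> h \<in> holohedry L" "\<And>y. h (h y) = y"
    for h :: "real \<Rightarrow> real"
    using that inv by (intro holohedry_inverse[OF that(1)]) auto
  then show ?thesis
    using assms orthogonal_transformation_inv[OF \<alpha>] by (auto simp: proj_holohedry_def)
qed

lemma proj_holohedry_fst_orbit:
  assumes "\<alpha> \<in> proj_holohedry y0 L" "u \<in> fst ` holohedry_orbit L k"
  shows "\<alpha> u \<in> fst ` holohedry_orbit L k"
proof -
  obtain z where z: "(u, z) \<in> holohedry_orbit L k" using assms(2) by force
  obtain h :: "real \<Rightarrow> real" where "map_prod \<alpha> h \<in> holohedry L"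
    using assms(1) by (auto simp: proj_holohedry_def)
  then have "map_prod \<alpha> h (u, z) \<in> holohedry_orbit L k" using z by (rule holohedry_orbit_closed)
  then show ?thesis by force
qed

lemma orthogonal_symmetry_proj:
  "orthogonal_symmetry (proj_lattice y0 L) (proj_holohedry y0 L)"
proof
  show "0 \<in> proj_lattice y0 L" by (simp add: proj_lattice_def)
  show "orthogonal_transformation \<alpha>" if "\<alpha> \<in> proj_holohedry y0 L" for \<alpha>
    using that by (simp add: proj_holohedry_def)
qed (fact id_in_proj_holohedry proj_holohedry_comp proj_holohedry_inv)+

text \<open>Vectors of the projected lattice fix every projected function by definition, in
  particular those of \<open>wave_space u\<close>, which forces \<open>wave u v = 1\<close>.\<close>

lemma mem_dual_proj_lattice:
  assumes "wave_space u \<subseteq> proj y0 ` periodic_space L"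
  shows "u \<in> dual (proj_lattice y0 L)"
  unfolding dual_def
proof (intro CollectI ballI)
  fix v assume "v \<in> proj_lattice y0 L"
  then have inv: "g (0 + v) = g 0" if "g \<in> wave_space u" for g
    using that assms unfolding proj_lattice_def by blast
  have "Re (c * wave u v) = Re c" for c
    using inv[OF wave_spaceI[of c u]] by simp
  \<comment> \<open>These two coefficients read off the real and imaginary parts of
    \<open>wave u v\<close>.\<close>
  from this[of 1] this[of \<i>] have "wave u v = 1" by (simp add: complex_eq_iff)
  then show "u \<bullet> v \<in> \<int>" by (simp add: wave_eq_1_iff)
qed

text \<open>The exceptional set is the countable set of integers divided by
  \<open>z\<close>.\<close>

lemma AE_not_Int_multiple:
  fixes z :: real
  assumes "z \<noteq> 0"
  shows "AE y in lebesgue. z * y \<notin> \<int>"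
proof -
  have "{y. z * y \<in> \<int>} = (\<lambda>m. m / z) ` \<int>"
    using assms by (force simp: image_iff)
  then have "countable {y. z * y \<in> \<int>}"
    by (simp add: Ints_def)
  then have "{y. z * y \<in> \<int>} \<in> null_sets lebesgue"
    by (intro null_sets_completionI countable_imp_null_set_lborel)
  then show ?thesis by (rule AE_I') auto
qed

theorem corollary10:
  fixes L :: "((real ^ 'n) \<times> real) set"
    and k :: "(real ^ 'n) \<times> real"
    and V :: "((real ^ 'n) \<times> real \<Rightarrow> real) set"
  assumes "full_lattice L"
    and "k \<in> dual L"
    and "irreducible_subspace (lattice_Gamma L) sym_act (periodic_space L) V"
    and "generated_by_orbit L k V"
    and "\<exists>u1 z1 u2 z2. (u1, z1) \<in> holohedry_orbit L k \<and> (u2, z2) \<in> holohedry_orbit L k \<and>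
           z1 \<noteq> z2 \<and> z1 \<noteq> - z2"
  shows "AE y0 in lebesgue. 0 < y0 \<longrightarrow>
    mode_interaction (proj_Gamma y0 L) sym_act (periodic_space (proj_lattice y0 L)) (proj y0 ` V)"
proof -
  obtain K where K: "K \<union> uminus ` K = holohedry_orbit L k" and V: "is_direct_sum K wave_space V"
    using assms(4) by (auto simp: generated_by_orbit_def)
  have finK: "finite K" using V unfolding is_direct_sum_def by (elim conjE)
  have VX: "V \<subseteq> periodic_space L"
    using assms(3) by (simp add: irreducible_subspace_def invariant_subspace_def)
  define P where "P = fst ` holohedry_orbit L k"
  have P: "P = fst ` K \<union> uminus ` (fst ` K)"
    unfolding P_def K[symmetric] by (simp add: image_Un image_image)
  obtain u1 z1 u2 z2 where u: "(u1, z1) \<in> holohedry_orbit L k" "(u2, z2) \<in> holohedry_orbit L k"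
    and z: "z1 \<noteq> z2" "z1 \<noteq> - z2"
    using assms(5) by blast
  have "norm (u1, z1) = norm (u2, z2)"
    using u norm_holohedry_orbit by metis
  then have norm_ne: "norm u1 \<noteq> norm u2"
    using z by (auto simp: norm_Pair power2_eq_iff)
  have "mode_interaction (proj_Gamma y0 L) sym_act (periodic_space (proj_lattice y0 L)) (proj y0 ` V)"
    if y0: "0 < y0" and K0: "\<forall>k\<in>K. snd k \<noteq> 0 \<longrightarrow> snd k * y0 \<notin> \<int>" for y0
  proof -
    interpret orthogonal_symmetry "proj_lattice y0 L" "proj_holohedry y0 L"
      by (rule orthogonal_symmetry_proj)
    have "proj y0 ` V = wave_span (fst ` K)"
      using proj_direct_sum_wave_space[OF V y0] K0 by blast
    \<comment> \<open>\<open>P\<close> is stable under negation and the projected holohedry; the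
      negatives it adds contribute the same wave spaces.\<close>
    also have "\<dots> = wave_span P"
      unfolding wave_span_def P by (simp add: image_Un UN_Un)
    finally have projV: "proj y0 ` V = wave_span P" .
    \<comment> \<open>Since \<open>V\<close> consists of periodic functions, each such wave space
      consists of projected functions.\<close>
    have "u \<in> dual (proj_lattice y0 L)" if "u \<in> P" for u
    proof (rule mem_dual_proj_lattice)
      have "wave_space u \<subseteq> wave_span P" using that by (rule wave_space_subset_wave_span)
      then show "wave_space u \<subseteq> proj y0 ` periodic_space L" using projV VX by blast
    qed
    moreover have "u1 \<in> P" "u2 \<in> P" using u by (force simp: P_def)+
    moreover have "finite P" using finK by (simp add: P)
    moreover have "- u \<in> P" if "u \<in> P" for u using that unfolding P by force
    moreover have "\<alpha> u \<in> P" if "\<alpha> \<in> proj_holohedry y0 L" "u \<in> P" for \<alpha> u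
      using that unfolding P_def by (rule proj_holohedry_fst_orbit)
    ultimately show ?thesis
      unfolding proj_Gamma_def projV
      using norm_ne by (intro mode_interaction_wave_span[of P u1 u2]) blast+
  qed
  \<comment> \<open>Finiteness of \<open>K\<close> leaves finitely many null sets to
    exclude.\<close>
  moreover have "AE y0 in lebesgue. \<forall>k\<in>K. snd k \<noteq> 0 \<longrightarrow> snd k * y0 \<notin> \<int>"
    using finK AE_not_Int_multiple by (intro AE_finite_allI) auto
  ultimately show ?thesis by (auto elim: eventually_mono)
qed

end
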